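(* Let $\alpha>0$, $\omega_k\ge 0$, $\lambda>1$ and $0<p_s<p_e$ be real constants, and let the renewable generation $s_k$ be a real random variable supported on $[s_{min},s_{max}]$ ($s_{min}<s_{max}$) having a density, whose cumulative distribution function $F_s$ is a continuous strictly increasing bijection from $[s_{min},s_{max}]$ onto $[0,1]$. Let $\pi$ be the probability weighting function and $v$ the value function given in the context, let $z_k=s_k-\frac{\omega_k-p_e}{\alpha}$ with cumulative distribution function $F_z$, and let $z_{2,min}=s_{min}-\frac{\omega_k-p_e}{\alpha}$, $z_{2,max}=s_{max}-\frac{\omega_k-p_e}{\alpha}$. For a contract amount $C_k\in[z_{2,min},z_{2,max}]$ let the prospect-theoretic valuation of the payment be $$E_p(C_k)=p_sC_k+p_e\int_{z_{2,min}}^{C_k}v(z-C_k)\,\frac{d}{dz}\big(\pi(F_z(z))\big)\,dz .$$ Then the optimal contract amount, i.e. the maximizer of $E_p$ over $[z_{2,min},z_{2,max}]$, is $$C_k^{*}=F_s^{-1}\!\left(\pi^{-1}\!\left(\frac{p_s}{\lambda p_e}\right)\right)+\frac{p_e-\omega_k}{\alpha}.$$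
   Context: Setting: a prosumer commits day-ahead to sell back an amount $C_k$ of energy in period $k$, is paid $p_s$ per committed unit, and pays a penalty $p_e$ per unit of shortfall, with $p_e>p_s$. The prosumer's parameter $\omega_k$ is his willingness for demand and $\alpha>0$ is the constant in his quadratic convenience function. When there is a shortfall, his real-time sell-back amount is $z_k=s_k-\frac{\omega_k-p_e}{\alpha}$, where $s_k$ is the random renewable generation. Value function (with unit exponents): $v(y)=y$ for $y\ge 0$ and $v(y)=\lambda y$ for $y<0$, where $\lambda>1$ is the loss-aversion coefficient. Probability weighting function: $\pi(q)=\exp(-(-\log q)^{\gamma})$ for $q\in(0,1]$, $\pi(0)=0$, where $\gamma\in(0,1)$ is a fixed constant. It is a continuous strictly increasing bijection of $[0,1]$ onto itself, so $\pi^{-1}$ is defined on $[0,1]$. *)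

theory Defs
  imports "HOL-Probability.Probability"
begin

definition value_fun :: "real \<Rightarrow> real \<Rightarrow> real" where
  "value_fun lam y = (if y \<ge> 0 then y else lam * y)"

text \<open>Only arguments in \<open>[0, 1]\<close> matter. At \<open>q = 1\<close> the formula gives the intended value \<open>1\<close>,
  because \<open>0 powr \<gamma> = 0\<close>.\<close>

definition prob_weight :: "real \<Rightarrow> real \<Rightarrow> real" where
  "prob_weight \<gamma> q = (if q = 0 then 0 else exp (- ((- ln q) powr \<gamma>)))"

text \<open>\<open>F\<close> is the cumulative distribution function of the real-time sell-back amount and \<open>zmin\<close> the
  left end of its range. \<open>deriv\<close> has an arbitrary value at points where \<open>\<lambda>t. prob_weight \<gamma> (F t)\<close> is not
  differentiable. For a law with a density these points form a null set, so they do not affect the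
  integral; the derivative may be unbounded near the ends of the range. For \<open>z < C\<close> the argument
  of the value function is negative, so the integrand is nonpositive almost everywhere on the
  domain of integration and the gauge integral agrees with the Lebesgue integral.\<close>

definition prospect_valuation ::
  "real \<Rightarrow> real \<Rightarrow> real \<Rightarrow> real \<Rightarrow> real \<Rightarrow> (real \<Rightarrow> real) \<Rightarrow> real \<Rightarrow> real" where
  "prospect_valuation \<gamma> lam ps pe zmin F C =
     ps * C + pe * integral {zmin..C}
       (\<lambda>z. value_fun lam (z - C) * deriv (\<lambda>t. prob_weight \<gamma> (F t)) z)"

end

theory Submission
  imports Defs "HOL-Real_Asymp.Real_Asymp"
begin

text \<open>Let \<open>G\<close> be the weighted distribution function \<open>prob_weight \<gamma> \<circ> Fz\<close>. Below the contract
  amount the value function is linear with slope \<open>lam\<close>, and \<open>G\<close> vanishes at \<open>zmin\<close>, so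
  integration by parts turns the valuation into \<open>ps * C - lam * pe * \<integral>G\<close> with the integral over \<open>[zmin, C]\<close>. Its derivative
  \<open>ps - lam * pe * G C\<close> is strictly decreasing, so the unique maximizer is the solution of
  \<open>G C = ps / (lam * pe)\<close>.

  The distribution function is only the integral of a density, so two facts stand in for the
  fundamental theorem of calculus: it is differentiable almost everywhere with the density as
  derivative (Lebesgue), and it transforms its own law into the uniform law on \<open>[0, 1]\<close>.\<close>

section \<open>Almost everywhere derivative of an indefinite integral\<close>

text \<open>The library provides the almost everywhere right derivative of an indefinite integral. The left
  one comes from reflecting the integrand.\<close>

lemma negligible_not_has_derivative_indefinite_integral:
  fixes g F :: "real \<Rightarrow> real"
  assumes int: "\<And>a b. g integrable_on {a..b}"
    and F: "\<And>a b. a \<le> b \<Longrightarrow> F b - F a = integral {a..b} g"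
  shows "negligible {x. \<not> (F has_real_derivative g x) (at x)}"
proof -
  obtain N1 where N1: "negligible N1"
    "\<And>x e. x \<notin> N1 \<Longrightarrow> 0 < e \<Longrightarrow> \<exists>d>0. \<forall>h. 0 < h \<and> h < d \<longrightarrow>
        \<bar>integral {x..x + h} g / h - g x\<bar> < e"
    using integrable_ccontinuous_explicit[of g] int by (auto simp: divide_inverse mult.commute)
  have int': "(\<lambda>x. g (- x)) integrable_on {a..b}" for a b
    using int[of "-b" "-a"]
      Henstock_Kurzweil_Integration.integrable_reflect_real[where f = g and a = "-b" and b = "-a"]
    by simp
  obtain N2 where N2: "negligible N2"
    "\<And>x e. x \<notin> N2 \<Longrightarrow> 0 < e \<Longrightarrow> \<exists>d>0. \<forall>h. 0 < h \<and> h < d \<longrightarrow>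
        \<bar>integral {x..x + h} (\<lambda>x. g (- x)) / h - g (- x)\<bar> < e"
    using integrable_ccontinuous_explicit[of "\<lambda>x. g (- x)"] int'
    by (auto simp: divide_inverse mult.commute)
  \<comment> \<open>The mirror image of the exceptional set of the reflected integrand covers the
    points where the left difference quotients fail to converge.\<close>
  have "negligible (uminus ` N2)"
    using N2(1) by (intro negligible_differentiable_image_negligible)
      (auto simp: differentiable_on_def intro!: derivative_intros)
  then have neg: "negligible (N1 \<union> uminus ` N2)"
    using N1(1) by auto
  have "(F has_real_derivative g x) (at x)" if x: "x \<notin> N1 \<union> uminus ` N2" for x
    unfolding DERIV_def
  proof (rule LIM_I)
    fix e :: real assume "0 < e"
    obtain d1 where d1: "d1 > 0" "\<And>h. 0 < h \<Longrightarrow> h < d1 \<Longrightarrow> \<bar>integral {x..x + h} g / h - g x\<bar> < e"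
      using N1(2)[of x e] x \<open>0 < e\<close> by auto
    have "- x \<notin> N2"
      using x by force
    then obtain d2 where d2: "d2 > 0"
      "\<And>h. 0 < h \<Longrightarrow> h < d2 \<Longrightarrow> \<bar>integral {-x..-x + h} (\<lambda>x. g (- x)) / h - g x\<bar> < e"
      using N2(2)[of "-x" e] \<open>0 < e\<close> by auto
    have "\<bar>(F (x + h) - F x) / h - g x\<bar> < e" if h: "h \<noteq> 0" "\<bar>h\<bar> < min d1 d2" for h
    proof (cases "h > 0")
      case True
      then show ?thesis using d1(2)[of h] F[of x "x + h"] h by simp
    next
      case False
      \<comment> \<open>For negative \<open>h\<close>, reflection turns the integral over
        \<open>{x + h..x}\<close> into one that starts at \<open>-x\<close> and has the positive
        length \<open>-h\<close>.\<close>
      have "integral {-x..-x + (-h)} (\<lambda>x. g (- x)) = F x - F (x + h)"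
        using F[of "x + h" x] False
          Henstock_Kurzweil_Integration.integral_reflect_real[where f = g and a = "x + h" and b = x]
        by (simp add: add.commute)
      then show ?thesis using d2(2)[of "-h"] False h 
        by (simp add: minus_divide_left[symmetric] diff_divide_distrib)
    qed
    then show "\<exists>s>0. \<forall>h. h \<noteq> 0 \<and> norm (h - 0) < s \<longrightarrow> norm ((F (x + h) - F x) / h - g x) < e"
      using d1(1) d2(1) by (intro exI[of _ "min d1 d2"]) auto
  qed
  then show ?thesis
    by (intro negligible_subset[OF neg]) blast
qed

section \<open>The weighting function: derivative, continuity and inverse\<close>

text \<open>The derivative of the Prelec weighting function. The value 0 outside the open unit
  interval makes points where a distribution function equals 0 or 1 drop out of integrals.\<close>

definition prob_weight_deriv :: "real \<Rightarrow> real \<Rightarrow> real" where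
  "prob_weight_deriv \<gamma> q =
     (if 0 < q \<and> q < 1 then prob_weight \<gamma> q * (\<gamma> * (- ln q) powr (\<gamma> - 1) / q) else 0)"

lemma prob_weight_deriv_nonneg: "0 \<le> \<gamma> \<Longrightarrow> 0 \<le> prob_weight_deriv \<gamma> q"
  by (auto simp: prob_weight_deriv_def prob_weight_def)

lemma borel_measurable_prob_weight_deriv [measurable]: "prob_weight_deriv \<gamma> \<in> borel_measurable borel"
  unfolding prob_weight_deriv_def prob_weight_def by measurable

lemma prob_weight_has_real_derivative:
  assumes "0 < q" "q < 1"
  shows "(prob_weight \<gamma> has_real_derivative prob_weight_deriv \<gamma> q) (at q)"
proof (rule has_field_derivative_transform_within_open[where S = "{0<..<1}"])
  show "((\<lambda>q. exp (- ((- ln q) powr \<gamma>))) has_real_derivative prob_weight_deriv \<gamma> q) (at q)"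
    using assms by (auto intro!: derivative_eq_intros simp: prob_weight_deriv_def prob_weight_def)
qed (use assms in \<open>auto simp: prob_weight_def\<close>)

lemma prob_weight_0 [simp]: "prob_weight \<gamma> 0 = 0"
  by (simp add: prob_weight_def)

lemma strict_mono_on_prob_weight:
  assumes "0 < \<gamma>"
  shows "strict_mono_on {0..1} (prob_weight \<gamma>)"
proof (rule strict_mono_onI)
  fix p q :: real assume "p \<in> {0..1}" "q \<in> {0..1}" "p < q"
  then show "prob_weight \<gamma> p < prob_weight \<gamma> q"
    using assms by (auto simp: prob_weight_def intro!: powr_less_mono2)
qed

text \<open>Only the ends need care. At 0, \<open>- ln q\<close> tends to infinity, so the
  exponential tends to 0; at 1 the base of the power tends to 0, and the exponent is
  positive.\<close>

lemma continuous_on_prob_weight: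
  assumes "0 < \<gamma>"
  shows "continuous_on {0..1} (prob_weight \<gamma>)"
  unfolding continuous_on_def
proof
  fix q :: real assume q: "q \<in> {0..1}"
  show "(prob_weight \<gamma> \<longlongrightarrow> prob_weight \<gamma> q) (at q within {0..1})"
  proof (cases "q = 0")
    case True
    have "((\<lambda>q. exp (- ((- ln q) powr \<gamma>))) \<longlongrightarrow> 0) (at_right 0)"
    proof (rule filterlim_compose[of "\<lambda>x::real. exp (- (x powr \<gamma>))" "nhds 0" at_top "\<lambda>q. - ln q"])
      show "((\<lambda>x. exp (- (x powr \<gamma>))) \<longlongrightarrow> 0) at_top" using assms by real_asymp
      show "filterlim (\<lambda>q::real. - ln q) at_top (at_right 0)" by real_asymp
    qed
    then have "(prob_weight \<gamma> \<longlongrightarrow> 0) (at_right 0)"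
      by (rule Lim_transform_eventually)
         (auto simp: prob_weight_def eventually_at_filter)
    then show ?thesis
      using True at_within_Icc_at_right[of 0 "1::real"] by simp
  next
    case False
    \<comment> \<open>A nonnegative base is what makes \<open>powr\<close> continuous at base 0,
      that is at \<open>q = 1\<close>. The case \<open>p = 0\<close> rests on the default value of
      \<open>ln\<close>.\<close>
    have "ln p \<le> 0" if "0 \<le> p" "p \<le> 1" for p :: real
      using that by (cases "p = 0") auto
    then have "((\<lambda>q. exp (- ((- ln q) powr \<gamma>))) \<longlongrightarrow> exp (- ((- ln q) powr \<gamma>))) (at q within {0..1})"
      using q assms False
      by (intro tendsto_intros tendsto_powr')
         (auto simp: eventually_at_filter intro!: always_eventually)
    moreover have "\<forall>\<^sub>F p in at q within {0..1}. p \<noteq> 0"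
      using False t1_space_nhds[of q 0] by (auto simp: eventually_at_filter elim: eventually_mono)
    ultimately show ?thesis
      using False by (auto simp: prob_weight_def elim!: Lim_transform_eventually eventually_mono)
  qed
qed

text \<open>Solving \<open>prob_weight \<gamma> q = p\<close> for \<open>q\<close> gives a closed
  form, and strict monotonicity makes it the only solution in the unit interval.\<close>

lemma inv_into_prob_weight:
  assumes "0 < \<gamma>" "0 < p" "p < 1"
  shows "inv_into {0..1} (prob_weight \<gamma>) p \<in> {0<..<1}"
    and "prob_weight \<gamma> (inv_into {0..1} (prob_weight \<gamma>) p) = p"
proof -
  define q where "q = exp (- ((- ln p) powr (1 / \<gamma>)))"
  have q: "q \<in> {0<..<1}" "prob_weight \<gamma> q = p"
    using assms by (auto simp: q_def prob_weight_def powr_powr)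
  then have "inv_into {0..1} (prob_weight \<gamma>) p = q"
    using strict_mono_on_imp_inj_on[OF strict_mono_on_prob_weight[OF assms(1)]]
    by (intro inv_into_f_eq) auto
  with q show "inv_into {0..1} (prob_weight \<gamma>) p \<in> {0<..<1}"
    and "prob_weight \<gamma> (inv_into {0..1} (prob_weight \<gamma>) p) = p" by auto
qed

text \<open>The fundamental theorem of calculus with differentiability in the interior only:
  continuity up to the ends copes with a derivative that may be unbounded there.\<close>

lemma nn_integral_prob_weight_deriv:
  assumes "0 < \<gamma>" "0 \<le> q" "q \<le> 1"
  shows "(\<integral>\<^sup>+u. ennreal (prob_weight_deriv \<gamma> u) * indicator {0..q} u \<partial>lborel) = ennreal (prob_weight \<gamma> q)"
proof -
  have "(prob_weight_deriv \<gamma> has_integral (prob_weight \<gamma> q - prob_weight \<gamma> 0)) {0..q}"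
  proof (rule fundamental_theorem_of_calculus_interior)
    show "continuous_on {0..q} (prob_weight \<gamma>)"
      using assms by (auto intro: continuous_on_subset[OF continuous_on_prob_weight])
  qed (use assms in \<open>auto intro!: prob_weight_has_real_derivative
      simp: has_real_derivative_iff_has_vector_derivative[symmetric]\<close>)
  then show ?thesis
    using assms by (auto dest!: nn_integral_has_integral_lebesgue'[rotated] simp: prob_weight_deriv_nonneg)
qed

section \<open>The probability integral transform\<close>

text \<open>At a level \<open>u\<close> in \<open>[0, 1)\<close> the sublevel set of the
  distribution function is a half-line \<open>{..x}\<close> with \<open>cdf M x = u\<close>, so its
  mass is \<open>u\<close>; all other levels are trivial.\<close>

lemma (in real_distribution) distr_cdf_uniform:
  assumes mono: "strict_mono_on {a..b} (cdf M)"
    and cont: "continuous_on {a..b} (cdf M)"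
    and ab: "a \<le> b" "cdf M a = 0" "cdf M b = 1"
  shows "distr M borel (cdf M) = uniform_measure lborel {0..1}"
proof (rule cdf_unique)
  have [measurable]: "cdf M \<in> borel_measurable borel"
    using cdf_nondecreasing by (intro borel_measurable_mono) (auto simp: mono_def)
  show "real_distribution (distr M borel (cdf M))"
    by (rule real_distribution_distr) measurable
  interpret U: prob_space "uniform_measure lborel {0..1::real}"
    by (rule prob_space_uniform_measure) auto
  show "real_distribution (uniform_measure lborel {0..1::real})"
    by unfold_locales auto
  show "cdf (distr M borel (cdf M)) = cdf (uniform_measure lborel {0..1})"
  proof
    fix u :: real
    have U: "cdf (uniform_measure lborel {0..1}) u = measure lborel ({0..1} \<inter> {..u})"
      by (simp add: cdf_def measure_uniform_measure)
    have V: "cdf (distr M borel (cdf M)) u = measure M {z. cdf M z \<le> u}"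
      by (subst cdf_def, subst measure_distr) (auto simp: vimage_def)
    consider "u < 0" | "u \<ge> 1" | "0 \<le> u" "u < 1" by linarith
    then show "cdf (distr M borel (cdf M)) u = cdf (uniform_measure lborel {0..1}) u"
    proof cases
      case 1
      then have "{z. cdf M z \<le> u} = {}" "{0..1} \<inter> {..u} = {}"
        using cdf_nonneg by (auto simp: not_le intro: less_le_trans)
      then show ?thesis by (simp only: U V measure_empty)
    next
      case 2
      then have "{z. cdf M z \<le> u} = space M" "{0..1} \<inter> {..u} = {0..1}"
        using cdf_bounded_prob by (auto intro: order_trans)
      then show ?thesis by (simp only: U V prob_space) simp
    next
      case 3
      obtain x where x: "a \<le> x" "x \<le> b" "cdf M x = u"
        using IVT'[of "cdf M" a u b] 3 ab cont by auto
      have "z \<le> x" if "cdf M z \<le> u" for z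
      proof (rule ccontr)
        assume "\<not> z \<le> x"
        \<comment> \<open>Strict monotonicity is given on \<open>{a..b}\<close> only, so
          \<open>z\<close> is cut off at \<open>b\<close>; \<open>u < 1\<close> keeps
          \<open>x\<close> below \<open>b\<close>.\<close>
        then have "x < min z b" using x 3 ab by (cases "x = b") auto
        then have "cdf M x < cdf M (min z b)"
          using x by (intro strict_mono_onD[OF mono]) auto
        also have "\<dots> \<le> cdf M z" by (intro cdf_nondecreasing) auto
        finally show False using that x by simp
      qed
      then have "{z. cdf M z \<le> u} = {..x}"
        using x(3) cdf_nondecreasing by (auto intro: order_trans)
      moreover have "{0..1} \<inter> {..u} = {0..u}" using 3 by auto
      ultimately show ?thesis using x 3 by (simp only: U V) (simp add: cdf_def)
    qed
  qed
qed

text \<open>The substitution \<open>u = cdf M z\<close>: the integrand depends on \<open>z\<close>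
  only through a uniformly distributed quantity, which leaves an integral of
  \<open>prob_weight_deriv \<gamma>\<close> over \<open>{0..cdf M t}\<close>.\<close>

lemma (in real_distribution) nn_integral_prob_weight_deriv_cdf:
  assumes mono: "strict_mono_on {a..b} (cdf M)"
    and cont: "continuous_on {a..b} (cdf M)"
    and ab: "a \<le> b" "cdf M a = 0" "cdf M b = 1"
    and t: "t \<in> {a..b}" and \<gamma>: "0 < \<gamma>"
  shows "(\<integral>\<^sup>+z. ennreal (prob_weight_deriv \<gamma> (cdf M z)) * indicator {a..t} z \<partial>M) =
    ennreal (prob_weight \<gamma> (cdf M t))"
proof -
  have [measurable]: "cdf M \<in> borel_measurable borel"
    using cdf_nondecreasing by (intro borel_measurable_mono) (auto simp: mono_def)
  let ?w = "\<lambda>u. ennreal (prob_weight_deriv \<gamma> u) * indicator {0..cdf M t} u"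
  have "prob_weight_deriv \<gamma> (cdf M z) = 0" if "z \<notin> {a..b}" for z
    using that cdf_nondecreasing[of z a] cdf_nondecreasing[of b z] ab
    by (auto simp: prob_weight_deriv_def)
  \<comment> \<open>This rewrites the cut-off at \<open>t\<close> as a condition on the value of the
    distribution function.\<close>
  moreover have "cdf M z \<le> cdf M t \<longleftrightarrow> z \<le> t" if "z \<in> {a..b}" for z
    using strict_mono_on_leD[OF mono, of z t] strict_mono_onD[OF mono, of t z] that t by force
  ultimately have "(\<integral>\<^sup>+z. ennreal (prob_weight_deriv \<gamma> (cdf M z)) * indicator {a..t} z \<partial>M) =
      (\<integral>\<^sup>+z. ?w (cdf M z) \<partial>M)"
    using t by (intro nn_integral_cong) (force simp: indicator_def cdf_nonneg)
  also have "\<dots> = (\<integral>\<^sup>+u. ?w u \<partial>distr M borel (cdf M))"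
    by (simp add: nn_integral_distr)
  also have "\<dots> = (\<integral>\<^sup>+u. ?w u * indicator {0..1} u \<partial>lborel)"
    unfolding distr_cdf_uniform[OF mono cont ab] by (subst nn_integral_uniform_measure) (auto simp: divide_ennreal_def)
  also have "\<dots> = (\<integral>\<^sup>+u. ?w u \<partial>lborel)"
    by (intro nn_integral_cong) (auto simp: indicator_def prob_weight_deriv_def)
  also have "\<dots> = ennreal (prob_weight \<gamma> (cdf M t))"
    using \<gamma> by (intro nn_integral_prob_weight_deriv) (auto simp: cdf_nonneg cdf_bounded_prob)
  finally show ?thesis .
qed

section \<open>The density as derivative of the distribution function\<close>

lemma negligible_not_cdf_has_derivative:
  fixes g :: "real \<Rightarrow> real"
  defines "\<mu> \<equiv> density lborel (\<lambda>x. ennreal (g x))"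
  assumes \<mu>: "real_distribution \<mu>"
    and [measurable]: "g \<in> borel_measurable borel" and nonneg: "\<And>x. 0 \<le> g x"
  shows "negligible {x. \<not> (cdf \<mu> has_real_derivative g x) (at x)}"
proof (rule negligible_not_has_derivative_indefinite_integral)
  interpret real_distribution \<mu> by fact
  have em: "emeasure \<mu> {a..b} = (\<integral>\<^sup>+x\<in>{a..b}. ennreal (g x) \<partial>lborel)" for a b
    by (simp add: \<mu>_def emeasure_density)
  have fin: "(\<integral>\<^sup>+x\<in>{a..b}. ennreal (g x) \<partial>lborel) < \<infinity>" for a b
    using emeasure_finite[of "{a..b}"] by (simp add: em less_top)
  show int: "g integrable_on {a..b}" for a b
  proof -
    have "integrable lborel (\<lambda>x. indicator {a..b} x * g x)"
      using fin[of a b] nonneg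
      by (intro integrableI_nonneg) (auto simp: indicator_mult_ennreal mult.commute ennreal_mult' ennreal_indicator)
    then have "set_integrable lborel {a..b} g"
      by (simp add: set_integrable_def)
    then show ?thesis by (rule set_borel_integral_eq_integral)
  qed
  show "cdf \<mu> b - cdf \<mu> a = integral {a..b} g" if "a \<le> b" for a b
  proof -
    \<comment> \<open>An increment of \<open>cdf\<close> measures \<open>{a<..b}\<close>, while the
      integral runs over \<open>{a..b}\<close>; the left end carries no mass.\<close>
    have sing: "emeasure \<mu> {a} = 0"
      unfolding \<mu>_def by (subst emeasure_density) (auto simp: nn_integral_0_iff_AE AE_lborel_singleton
         intro!: AE_I'[of "{a}"])
    have "cdf \<mu> b - cdf \<mu> a = measure \<mu> {a<..b}"
      using that by (cases "a = b") (auto simp: cdf_diff_eq)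
    also have "{a<..b} = {a..b} - {a}" by auto
    also have "measure \<mu> ({a..b} - {a}) = measure \<mu> {a..b}"
      using sing by (intro measure_Diff_null_set) (auto simp: null_sets_def)
    finally have *: "ennreal (cdf \<mu> b - cdf \<mu> a) = emeasure \<mu> {a..b}"
      by (simp add: emeasure_eq_measure)
    also have "\<dots> = ennreal (integral {a..b} g)"
      unfolding em by (intro set_nn_integral_lborel_eq_integral fin nonneg)
         (auto simp: set_borel_measurable_def)
    finally show ?thesis
      using that nonneg int by (simp add: integral_nonneg cdf_nondecreasing)
  qed
qed

section \<open>The integral in the valuation\<close>

text \<open>Writing \<open>C - z\<close> as the length of \<open>[z, C]\<close> and exchanging the order of integration
  replaces the integration by parts, for which \<open>prob_weight \<gamma> \<circ> F\<close> would have to be known to be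
  absolutely continuous.\<close>

lemma
  fixes g :: "real \<Rightarrow> real" and a b C lam \<gamma> :: real
  defines "F \<equiv> cdf (density lborel (\<lambda>x. ennreal (g x)))"
  assumes \<mu>: "real_distribution (density lborel (\<lambda>x. ennreal (g x)))"
    and [measurable]: "g \<in> borel_measurable borel" and nonneg: "\<And>x. 0 \<le> g x"
    and mono: "strict_mono_on {a..b} F" and cont: "continuous_on {a..b} F"
    and ab: "a \<le> b" "F a = 0" "F b = 1"
    and C: "C \<in> {a..b}" and \<gamma>: "0 < \<gamma>"
  shows continuous_on_prob_weight_cdf: "continuous_on {a..b} (\<lambda>z. prob_weight \<gamma> (F z))"
    and integral_value_fun_deriv_prob_weight_cdf:
    "integral {a..C} (\<lambda>z. value_fun lam (z - C) * deriv (\<lambda>t. prob_weight \<gamma> (F t)) z) =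
      - lam * integral {a..C} (\<lambda>t. prob_weight \<gamma> (F t))"
proof -
  interpret real_distribution "density lborel (\<lambda>x. ennreal (g x))" by fact
  have F01: "0 \<le> F z" "F z \<le> 1" for z
    unfolding F_def by (rule cdf_nonneg, rule cdf_bounded_prob)
  have [measurable]: "F \<in> borel_measurable borel"
    unfolding F_def using cdf_nondecreasing by (intro borel_measurable_mono) (auto simp: mono_def)
  have w_nonneg: "0 \<le> prob_weight \<gamma> p" for p
    by (simp add: prob_weight_def)
  have w'_nonneg: "0 \<le> prob_weight_deriv \<gamma> p" for p
    using \<gamma> by (simp add: prob_weight_deriv_nonneg)
  show cont_G: "continuous_on {a..b} (\<lambda>z. prob_weight \<gamma> (F z))"
    by (rule continuous_on_compose2[OF continuous_on_prob_weight[OF \<gamma>] cont]) (use F01 in auto)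
  let ?h = "\<lambda>z. prob_weight_deriv \<gamma> (F z) * g z"
  let ?I = "integral {a..C} (\<lambda>t. prob_weight \<gamma> (F t))"
  \<comment> \<open>A kernel on the triangle \<open>a \<le> z \<le> t \<le> C\<close>. Integrating
    over \<open>t\<close> first yields the factor \<open>C - z\<close>; integrating over
    \<open>z\<close> first yields the weighted distribution function at \<open>t\<close>.\<close>
  let ?k = "\<lambda>z t. if a \<le> z \<and> z \<le> t \<and> t \<le> C then ennreal (?h z) else 0"
  have "continuous_on {a..C} (\<lambda>z. prob_weight \<gamma> (F z))"
    using C by (intro continuous_on_subset[OF cont_G]) auto
  then have I: "((\<lambda>t. prob_weight \<gamma> (F t)) has_integral ?I) {a..C}"
    by (intro integrable_integral integrable_continuous_real)
  have "(\<integral>\<^sup>+z. ennreal (indicator {a..C} z * ((C - z) * ?h z)) \<partial>lborel) =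
      (\<integral>\<^sup>+z. (\<integral>\<^sup>+t. ?k z t \<partial>lborel) \<partial>lborel)"
  proof (rule nn_integral_cong)
    fix z
    have "(\<integral>\<^sup>+t. ?k z t \<partial>lborel) = (\<integral>\<^sup>+t. (ennreal (?h z) * indicator {a..} z) * indicator {z..C} t \<partial>lborel)"
      by (intro nn_integral_cong) (auto simp: indicator_def)
    also have "\<dots> = (ennreal (?h z) * indicator {a..} z) * emeasure lborel {z..C}"
      by (subst nn_integral_cmult) auto
    also have "\<dots> = ennreal (indicator {a..C} z * ((C - z) * ?h z))"
      using nonneg w'_nonneg by (cases "z \<le> C") (auto simp: indicator_def ennreal_mult mult.commute)
    finally show "ennreal (indicator {a..C} z * ((C - z) * ?h z)) = (\<integral>\<^sup>+t. ?k z t \<partial>lborel)" ..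
  qed
  also have "\<dots> = (\<integral>\<^sup>+t. (\<integral>\<^sup>+z. ?k z t \<partial>lborel) \<partial>lborel)"
    by (rule lborel_pair.Fubini') measurable
  also have "\<dots> = (\<integral>\<^sup>+t. ennreal (prob_weight \<gamma> (F t)) * indicator {a..C} t \<partial>lborel)"
  proof (rule nn_integral_cong)
    fix t
    show "(\<integral>\<^sup>+z. ?k z t \<partial>lborel) = ennreal (prob_weight \<gamma> (F t)) * indicator {a..C} t"
    proof (cases "t \<in> {a..C}")
      case True
      then have "(\<integral>\<^sup>+z. ?k z t \<partial>lborel) =
          (\<integral>\<^sup>+z. ennreal (g z) * (ennreal (prob_weight_deriv \<gamma> (F z)) * indicator {a..t} z) \<partial>lborel)"
        using nonneg w'_nonneg by (intro nn_integral_cong) (auto simp: ennreal_mult mult_ac)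
      also have "\<dots> = (\<integral>\<^sup>+z. ennreal (prob_weight_deriv \<gamma> (F z)) * indicator {a..t} z
          \<partial>density lborel (\<lambda>x. ennreal (g x)))"
        by (simp add: nn_integral_density)
      also have "\<dots> = ennreal (prob_weight \<gamma> (F t))"
        using True C nn_integral_prob_weight_deriv_cdf[of a b t \<gamma>] mono cont ab \<gamma> by (simp add: F_def)
      finally show ?thesis using True by simp
    next
      case False
      then have "?k z t = 0" for z by (auto simp: indicator_def)
      then show ?thesis using False by simp
    qed
  qed
  also have "\<dots> = ennreal ?I"
    by (rule nn_integral_has_integral_lebesgue'[OF w_nonneg I])
  \<comment> \<open>Finiteness of this nonnegative integral yields gauge integrability, even where
    \<open>?h\<close> is unbounded.\<close>
  finally have "((\<lambda>z. indicator {a..C} z * ((C - z) * ?h z)) has_integral ?I) UNIV"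
    using nonneg w'_nonneg has_integral_nonneg[OF I] w_nonneg
    by (intro nn_integral_has_integral) (auto simp: indicator_def)
  then have "((\<lambda>z. (C - z) * ?h z) has_integral ?I) {a..C}"
    by (subst has_integral_restrict_UNIV[symmetric])
       (erule has_integral_eq[rotated], auto simp: indicator_def)
  then have J: "((\<lambda>z. - lam * ((C - z) * ?h z)) has_integral - lam * ?I) {a..C}"
    by (rule has_integral_mult_right)
  \<comment> \<open>Off this set the chain rule applies. The ends are included because
    \<open>F\<close> is 0 at \<open>a\<close> and may be 1 at \<open>C\<close>, outside the range
    where \<open>prob_weight_has_real_derivative\<close> speaks.\<close>
  let ?N = "{x. \<not> (F has_real_derivative g x) (at x)} \<union> {a, C}"
  have "negligible ?N"
    unfolding F_def using negligible_not_cdf_has_derivative[OF \<mu> _ nonneg] by simp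
  moreover have "value_fun lam (z - C) * deriv (\<lambda>t. prob_weight \<gamma> (F t)) z = - lam * ((C - z) * ?h z)"
    if z: "z \<in> {a..C} - ?N" for z
  proof -
    have "F a < F z" "F z < F b"
      using z C by (auto intro!: strict_mono_onD[OF mono])
    then have "((\<lambda>t. prob_weight \<gamma> (F t)) has_real_derivative ?h z) (at z)"
      using z ab by (intro DERIV_chain2[of "prob_weight \<gamma>"] prob_weight_has_real_derivative) auto
    then show ?thesis
      using z by (simp add: DERIV_imp_deriv value_fun_def algebra_simps)
  qed
  ultimately show "integral {a..C} (\<lambda>z. value_fun lam (z - C) * deriv (\<lambda>t. prob_weight \<gamma> (F t)) z) =
      - lam * ?I"
    by (intro integral_unique has_integral_spike[OF _ _ J])
qed

section \<open>Maximizing a strictly concave function\<close>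

text \<open>The derivative \<open>p - k * G x\<close> is positive left of \<open>c\<close> and
  negative right of it, so by the mean value theorem every other point has a strictly smaller value.
  Strictness gives uniqueness.\<close>

lemma is_arg_max_concave_integral:
  fixes G :: "real \<Rightarrow> real"
  assumes cont: "continuous_on {a..b} G" and mono: "strict_mono_on {a..b} G"
    and c: "c \<in> {a..b}" "k * G c = p" and k: "k > 0"
    and E: "\<And>x. x \<in> {a..b} \<Longrightarrow> E x = p * x - k * integral {a..x} G"
  shows "is_arg_max E (\<lambda>x. x \<in> {a..b}) x \<longleftrightarrow> x = c"
proof -
  have "E y < E c" if y: "y \<in> {a..b}" "y \<noteq> c" for y
  proof -
    \<comment> \<open>Ordering the two points lets one use of the mean value theorem serve both
      sides of \<open>c\<close>.\<close>
    define u v where "u = min y c" and "v = max y c"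
    have uv: "a \<le> u" "u < v" "v \<le> b"
      using y c by (auto simp: u_def v_def)
    have "\<exists>\<xi>\<in>{u<..<v}. (p * v - k * integral {a..v} G) - (p * u - k * integral {a..u} G) =
        (p - k * G \<xi>) * (v - u)"
    proof (rule mvt_simple[OF \<open>u < v\<close>])
      fix x assume x: "u \<le> x" "x \<le> v"
      have "((\<lambda>x. integral {a..x} G) has_real_derivative G x) (at x within {a..b})"
        using x uv by (intro integral_has_real_derivative cont) auto
      then have "((\<lambda>x. integral {a..x} G) has_real_derivative G x) (at x within {u..v})"
        by (rule DERIV_subset) (use uv in auto)
      then have "((\<lambda>x. p * x - k * integral {a..x} G) has_real_derivative p - k * G x)
          (at x within {u..v})"
        by (auto intro!: derivative_eq_intros)
      then show "((\<lambda>x. p * x - k * integral {a..x} G) has_derivative (*) (p - k * G x))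
          (at x within {u..v})"
        by (rule has_field_derivative_imp_has_derivative)
    qed
    then obtain \<xi> where \<xi>: "u < \<xi>" "\<xi> < v"
      "(p * v - k * integral {a..v} G) - (p * u - k * integral {a..u} G) = (v - u) * (p - k * G \<xi>)"
      by (auto simp: mult.commute)
    then have diff: "E v - E u = (v - u) * (p - k * G \<xi>)"
      using uv by (simp add: E)
    show "E y < E c"
    proof (cases "y < c")
      case True
      then have "G \<xi> < G c"
        using \<xi> c y by (intro strict_mono_onD[OF mono]) (auto simp: u_def v_def)
      then have "k * G \<xi> < p"
        using k by (simp flip: c(2))
      then have "0 < E v - E u" using uv by (simp add: diff)
      then show ?thesis using True by (simp add: u_def v_def)
    next
      case False
      then have "G c < G \<xi>"
        using \<xi> c y by (intro strict_mono_onD[OF mono]) (auto simp: u_def v_def)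
      then have "p < k * G \<xi>"
        using k by (simp flip: c(2))
      then have "E v - E u < 0" using uv by (simp add: diff mult_pos_neg)
      then show ?thesis using False y by (simp add: u_def v_def)
    qed
  qed
  then show ?thesis
    using c(1) by (force simp: is_arg_max_def)
qed

section \<open>The optimal contract amount\<close>

theorem theorem1:
  fixes M :: "'a measure" and s :: "'a \<Rightarrow> real" and f :: "real \<Rightarrow> ennreal"
    and \<alpha> \<omega> lam ps pe \<gamma> smin smax C :: real
  defines "offs \<equiv> (\<omega> - pe) / \<alpha>"
  defines "Fs \<equiv> cdf (distr M borel s)"
    and "Fz \<equiv> cdf (distr M borel (\<lambda>x. s x - offs))"
    and "zmin \<equiv> smin - offs"
    and "zmax \<equiv> smax - offs"
  assumes "prob_space M"
    and "\<alpha> > 0" and "\<omega> \<ge> 0" and "lam > 1" and "0 < ps" and "ps < pe"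
    and "0 < \<gamma>" and "\<gamma> < 1"
    and "smin < smax"
    and density: "distributed M lborel s f"
    and supported: "AE x in M. s x \<in> {smin..smax}"
    and "continuous_on {smin..smax} Fs"
    and "strict_mono_on {smin..smax} Fs"
    and "bij_betw Fs {smin..smax} {0..1}"
  shows "is_arg_max (prospect_valuation \<gamma> lam ps pe zmin Fz) (\<lambda>C. C \<in> {zmin..zmax}) C \<longleftrightarrow>
    C = inv_into {smin..smax} Fs (inv_into {0..1} (prob_weight \<gamma>) (ps / (lam * pe))) + (pe - \<omega>) / \<alpha>"
proof -
  interpret prob_space M by fact
  have s[measurable]: "s \<in> borel_measurable M"
    using distributed_measurable[OF density] by simp
  have f[measurable]: "f \<in> borel_measurable borel"
    using distributed_borel_measurable[OF density] by simp
  have mono: "strict_mono_on {smin..smax} Fs" and cont: "continuous_on {smin..smax} Fs"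
    and bij: "bij_betw Fs {smin..smax} {0..1}" by fact+
  \<comment> \<open>Being increasing and onto \<open>{0..1}\<close>, \<open>Fs\<close> must take the
    values 0 and 1 at the ends of the support.\<close>
  have "0 \<in> Fs ` {smin..smax}" "1 \<in> Fs ` {smin..smax}" and img: "Fs ` {smin..smax} = {0..1}"
    using bij by (auto simp: bij_betw_def)
  then obtain x0 x1 where x: "x0 \<in> {smin..smax}" "Fs x0 = 0" "x1 \<in> {smin..smax}" "Fs x1 = 1"
    by (metis imageE)
  have "Fs smin \<le> Fs x0" "Fs x1 \<le> Fs smax"
    using x strict_mono_on_leD[OF mono, of smin x0] strict_mono_on_leD[OF mono, of x1 smax] by simp_all
  moreover have "Fs smin \<in> {0..1}" "Fs smax \<in> {0..1}"
    using \<open>smin < smax\<close> by (auto simp flip: img)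
  ultimately have ends: "Fs smin = 0" "Fs smax = 1"
    using x by auto
  have Fz: "Fz z = Fs (z + offs)" for z
    unfolding Fz_def Fs_def cdf_def
    by (simp add: measure_distr vimage_def) (simp add: algebra_simps)
  \<comment> \<open>The density \<open>f\<close> has extended values. Its integral is finite, so it
    is finite almost everywhere, and this shifted real version gives the law of the sell-back
    amount.\<close>
  define g where "g = (\<lambda>z. enn2real (f (z + offs)))"
  have [measurable]: "g \<in> borel_measurable borel"
    unfolding g_def by measurable
  have dist: "distributed M lborel (\<lambda>x. s x - offs) (\<lambda>z. f (z + offs))"
    using distributed_affine[OF density, of 1 "- offs"] by (simp add: divide_ennreal_def)
  have "AE z in lborel. f (z + offs) \<noteq> \<infinity>"
  proof (rule nn_integral_PInf_AE)
    show "(\<integral>\<^sup>+z. f (z + offs) \<partial>lborel) \<noteq> \<infinity>"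
      using distributed_emeasure[OF dist, of UNIV] emeasure_finite[of "space M"] by (simp add: vimage_def)
  qed simp
  then have "density lborel (\<lambda>z. f (z + offs)) = density lborel (\<lambda>z. ennreal (g z))"
    by (intro density_cong) (auto simp: g_def less_top)
  then have "distr M borel (\<lambda>x. s x - offs) = density lborel (\<lambda>z. ennreal (g z))"
    using distributed_distr_eq_density[OF dist] by (simp cong: distr_cong)
  then have Fz_density: "Fz = cdf (density lborel (\<lambda>z. ennreal (g z)))"
    and rd: "real_distribution (density lborel (\<lambda>z. ennreal (g z)))"
    by (auto simp: Fz_def simp flip: \<open>distr M borel _ = _\<close>)
  have g_nonneg: "0 \<le> g z" for z by (simp add: g_def)
  have monoz: "strict_mono_on {zmin..zmax} Fz"
    by (auto simp: Fz zmin_def zmax_def intro!: strict_mono_onI strict_mono_onD[OF mono])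
  have contz: "continuous_on {zmin..zmax} Fz"
    unfolding Fz
    by (intro continuous_on_compose2[OF cont] continuous_intros) (auto simp: zmin_def zmax_def)
  have endsz: "zmin \<le> zmax" "Fz zmin = 0" "Fz zmax = 1"
    using ends \<open>smin < smax\<close> by (auto simp: Fz zmin_def zmax_def)
  note core = rd _ g_nonneg monoz[unfolded Fz_density] contz[unfolded Fz_density] endsz[unfolded Fz_density]
  \<comment> \<open>The level of the weighted distribution function at which the derivative
    \<open>ps - lam * pe * prob_weight \<gamma> (Fz C)\<close> vanishes.\<close>
  define p where "p = ps / (lam * pe)"
  define q where "q = inv_into {0..1} (prob_weight \<gamma>) p"
  have p: "0 < p" "p < 1"
  proof -
    have "0 < pe" using \<open>0 < ps\<close> \<open>ps < pe\<close> by simp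
    then have "pe < lam * pe" using \<open>lam > 1\<close> by simp
    then have "ps < lam * pe" using \<open>ps < pe\<close> by simp
    then show "0 < p" "p < 1"
      using \<open>lam > 1\<close> \<open>0 < ps\<close> \<open>0 < pe\<close> by (simp_all add: p_def)
  qed
  have q: "q \<in> {0<..<1}" "prob_weight \<gamma> q = p"
    unfolding q_def by (intro inv_into_prob_weight \<open>0 < \<gamma>\<close> p)+
  \<comment> \<open>The solution of \<open>Fz C = q\<close>: since \<open>Fz\<close> is
    \<open>Fs\<close> shifted by \<open>offs\<close>, so is its inverse, and \<open>- offs\<close>
    is the summand \<open>(pe - \<omega>) / \<alpha>\<close>.\<close>
  let ?c = "inv_into {smin..smax} Fs q - offs"
  have "q \<in> Fs ` {smin..smax}" using q by (simp add: img)
  then have c: "?c \<in> {zmin..zmax}" "Fz ?c = q"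
    using inv_into_into[of q Fs "{smin..smax}"] by (auto simp: zmin_def zmax_def Fz f_inv_into_f)
  have "is_arg_max (prospect_valuation \<gamma> lam ps pe zmin Fz) (\<lambda>C. C \<in> {zmin..zmax}) C \<longleftrightarrow> C = ?c"
  proof (rule is_arg_max_concave_integral[where k = "lam * pe" and p = ps
        and G = "\<lambda>z. prob_weight \<gamma> (Fz z)"])
    show "continuous_on {zmin..zmax} (\<lambda>z. prob_weight \<gamma> (Fz z))"
      unfolding Fz_density by (rule continuous_on_prob_weight_cdf[OF core]) (use endsz \<open>0 < \<gamma>\<close> in auto)
    have "0 \<le> Fz z \<and> Fz z \<le> 1" if "z \<in> {zmin..zmax}" for z
      using that endsz strict_mono_on_leD[OF monoz, of zmin z]
        strict_mono_on_leD[OF monoz, of z zmax] by auto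
    then show "strict_mono_on {zmin..zmax} (\<lambda>z. prob_weight \<gamma> (Fz z))"
      by (auto intro!: strict_mono_onI strict_mono_onD[OF strict_mono_on_prob_weight[OF \<open>0 < \<gamma>\<close>]]
          strict_mono_onD[OF monoz])
    show "lam * pe * prob_weight \<gamma> (Fz ?c) = ps" "0 < lam * pe"
      using \<open>lam > 1\<close> \<open>0 < ps\<close> \<open>ps < pe\<close> by (auto simp: c q p_def)
    show "prospect_valuation \<gamma> lam ps pe zmin Fz x =
        ps * x - lam * pe * integral {zmin..x} (\<lambda>z. prob_weight \<gamma> (Fz z))" if "x \<in> {zmin..zmax}" for x
      unfolding prospect_valuation_def Fz_density
      by (subst integral_value_fun_deriv_prob_weight_cdf[OF core that]) (use \<open>0 < \<gamma>\<close> in auto)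
  qed fact
  also have "?c = inv_into {smin..smax} Fs q + (pe - \<omega>) / \<alpha>"
    by (simp add: offs_def diff_divide_distrib)
  finally show ?thesis by (simp add: q_def p_def)
qed

end
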